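(* For $V=\mathbb R^d$, define the linear map $H_V\colon T(V)\to T(V)$ by $H_V(w)=p_w$ for every word $w$, where $p_w$ is the block-orthogonalisation of $w$ with respect to the (Stratonovich) signature of $d$-dimensional Brownian motion on $[0,1]$. Then $H_V$ is not natural for $d\ge2$; that is, the family $\{H_{\mathbb R^d}\}_{d\ge2}$ is not natural.
   Context: $T(V)=\bigoplus_{n\ge0}V^{\otimes n}$; for $V=\mathbb R^d$ (with its standard inner product, identifying $V$ with $V^*$) it has as basis the words in the alphabet $\{1,\dots,d\}$; $|w|$ is the length of $w$. The expected Stratonovich signature of $d$-dimensional standard Brownian motion on $[0,1]$ is $$\mathbb E S=\exp\Big(\tfrac12\sum_{\gamma=1}^d\gamma\gamma\Big)=\sum_{n\ge0}\frac1{2^nn!}\sum_{\gamma_1,\dots,\gamma_n=1}^d\gamma_1\gamma_1\cdots\gamma_n\gamma_n .$$ The inner product on $T(\mathbb R^d)$ is $(u,v)=\langle u\sqcup\!\sqcup v,\mathbb E S\rangle$, where $\sqcup\!\sqcup$ is the shuffle product and $\langle\cdot,\cdot\rangle$ is the pairing in which words are orthonormal. For a word $w$ with $|w|=n$, $p_w$ is $w$ minus its $(\cdot,\cdot)$-orthogonal projection onto the span of all words of length at most $n-1$. Naturality: a family of linear maps $H_V\colon T(V)\to T(V)$, indexed by Euclidean spaces $V$, is called natural if $T(\varphi)\circ H_V=H_W\circ T(\varphi)$ for every injective linear isometry $\varphi\colon V\to W$, where $T(\varphi)(v_1\cdots v_n)=\varphi(v_1)\cdots\varphi(v_n)$. 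*)

theory Defs
  imports Complex_Main "HOL-Library.Poly_Mapping" "HOL-Library.Multiset"
begin

(* Free monoid structure on words. It turns  nat list =>0 real  with the convolution product
   of Poly_Mapping into the free associative algebra (tensor algebra). *)
instantiation list :: (type) monoid_add
begin
definition zero_list_def: "0 = []"
definition plus_list_def: "u + v = u @ v"
instance
  by standard (simp_all add: zero_list_def plus_list_def)
end

instantiation poly_mapping :: (type, real_vector) real_vector
begin
lift_definition scaleR_poly_mapping :: "real \<Rightarrow> ('a \<Rightarrow>\<^sub>0 'b) \<Rightarrow> 'a \<Rightarrow>\<^sub>0 'b"
  is "\<lambda>c f k. c *\<^sub>R f k"
  by (rule finite_subset) auto
instance
  by standard (transfer, auto simp: algebra_simps)+
end

lemma lookup_scaleR [simp]: "Poly_Mapping.lookup (c *\<^sub>R f) k = c *\<^sub>R Poly_Mapping.lookup f k"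
  by transfer simp

lemma poly_mapping_eq_sum_single:
  "f = (\<Sum>k\<in>Poly_Mapping.keys f. Poly_Mapping.single k (Poly_Mapping.lookup f k))"
proof (rule poly_mapping_eqI)
  fix k
  show "Poly_Mapping.lookup f k =
    Poly_Mapping.lookup (\<Sum>k\<in>Poly_Mapping.keys f. Poly_Mapping.single k (Poly_Mapping.lookup f k)) k"
    by (auto simp: lookup_sum lookup_single when_def in_keys_iff if_distrib sum.delta cong: if_cong)
qed

lemma scaleR_single: "c *\<^sub>R Poly_Mapping.single k a = Poly_Mapping.single k (c *\<^sub>R a)"
  by (rule poly_mapping_eqI) (simp add: lookup_single when_def)

instance poly_mapping :: (monoid_add, real_algebra_1) real_algebra_1
proof
  fix c :: real and f g :: "'a \<Rightarrow>\<^sub>0 'b"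
  let ?s = "\<lambda>f. \<Sum>k\<in>Poly_Mapping.keys f. Poly_Mapping.single k (Poly_Mapping.lookup f k)"
  have "(c *\<^sub>R ?s f) * ?s g = c *\<^sub>R (?s f * ?s g)"
    by (simp add: sum_product scaleR_sum_right scaleR_single mult_single)
  then show "(c *\<^sub>R f) * g = c *\<^sub>R (f * g)"
    by (simp flip: poly_mapping_eq_sum_single)
  have "?s f * (c *\<^sub>R ?s g) = c *\<^sub>R (?s f * ?s g)"
    by (simp add: sum_product scaleR_sum_right scaleR_single mult_single)
  then show "f * (c *\<^sub>R g) = c *\<^sub>R (f * g)"
    by (simp flip: poly_mapping_eq_sum_single)
qed

type_synonym vect = "nat \<Rightarrow>\<^sub>0 real"
type_synonym tensor = "nat list \<Rightarrow>\<^sub>0 real"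

definition lin_ext :: "('a \<Rightarrow> 'v) \<Rightarrow> ('a \<Rightarrow>\<^sub>0 real) \<Rightarrow> 'v::real_vector" where
  "lin_ext h f = (\<Sum>a\<in>Poly_Mapping.keys f. Poly_Mapping.lookup f a *\<^sub>R h a)"

lemma lin_ext_superset:
  assumes "finite A" "Poly_Mapping.keys f \<subseteq> A"
  shows "lin_ext h f = (\<Sum>a\<in>A. Poly_Mapping.lookup f a *\<^sub>R h a)"
  unfolding lin_ext_def
  by (rule sum.mono_neutral_left) (use assms in \<open>auto simp: in_keys_iff\<close>)

lemma linear_lin_ext: "linear (lin_ext h)"
proof
  fix f g :: "'a \<Rightarrow>\<^sub>0 real" and c :: real
  let ?A = "Poly_Mapping.keys f \<union> Poly_Mapping.keys g"
  have "lin_ext h (f + g) = (\<Sum>a\<in>?A. Poly_Mapping.lookup (f + g) a *\<^sub>R h a)"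
    by (rule lin_ext_superset) (auto simp: in_keys_iff lookup_add)
  also have "\<dots> = lin_ext h f + lin_ext h g"
    by (simp add: lin_ext_superset[of ?A] lookup_add scaleR_add_left sum.distrib)
  finally show "lin_ext h (f + g) = lin_ext h f + lin_ext h g" .
  have "lin_ext h (c *\<^sub>R f) = (\<Sum>a\<in>?A. Poly_Mapping.lookup (c *\<^sub>R f) a *\<^sub>R h a)"
    by (rule lin_ext_superset) (auto simp: in_keys_iff)
  also have "\<dots> = c *\<^sub>R lin_ext h f"
    by (simp add: lin_ext_superset[of ?A] scaleR_sum_right)
  finally show "lin_ext h (c *\<^sub>R f) = c *\<^sub>R lin_ext h f" .
qed

definition word :: "nat list \<Rightarrow> tensor" where
  "word w = Poly_Mapping.single w 1"

lemma lin_ext_word [simp]: "lin_ext h (word w) = h w"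
  by (simp add: lin_ext_def word_def)

lemma word_mult: "word u * word v = word (u @ v)"
  by (simp add: word_def mult_single plus_list_def)

lemma word_Nil: "word [] = 1"
  by (simp add: word_def zero_list_def[symmetric])

definition tensor_space :: "nat \<Rightarrow> tensor set" where
  "tensor_space d = span (word ` lists {1..d})"

(* List.shuffles is a set and loses the multiplicities of the shuffle product. *)
fun shuffle_words :: "nat list \<Rightarrow> nat list \<Rightarrow> nat list multiset" where
  "shuffle_words [] v = {#v#}"
| "shuffle_words u [] = {#u#}"
| "shuffle_words (a # u) (b # v) =
     image_mset ((#) a) (shuffle_words u (b # v)) + image_mset ((#) b) (shuffle_words (a # u) v)"

definition shuffle_product :: "tensor \<Rightarrow> tensor \<Rightarrow> tensor" where
  "shuffle_product f g = lin_ext (\<lambda>u. lin_ext (\<lambda>v. \<Sum>w\<in>#shuffle_words u v. word w) g) f"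

(* Tensor series are arbitrary coefficient functions on words. For x without constant term the
   coefficient of every word in the exponential series is a sum with finitely many nonzero terms. *)
definition tensor_exp :: "tensor \<Rightarrow> nat list \<Rightarrow> real" where
  "tensor_exp x w = suminf (\<lambda>n. Poly_Mapping.lookup (x ^ n) w / fact n)"

definition pairing :: "tensor \<Rightarrow> (nat list \<Rightarrow> real) \<Rightarrow> real" where
  "pairing f S = lin_ext S f"

(* Expected Stratonovich signature of standard Brownian motion in R^d on [0,1],
   given by its exponential formula. *)
definition expected_signature :: "nat \<Rightarrow> nat list \<Rightarrow> real" where
  "expected_signature d = tensor_exp ((1/2) *\<^sub>R (\<Sum>\<gamma>\<in>{1..d}. word [\<gamma>, \<gamma>]))"

lemma power_sum_letter_squares:
  "(\<Sum>\<gamma>\<in>{1..d}. word [\<gamma>, \<gamma>]) ^ n =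
     (\<Sum>\<gamma>s | set \<gamma>s \<subseteq> {1..d} \<and> length \<gamma>s = n. word (concat (map (\<lambda>\<gamma>. [\<gamma>, \<gamma>]) \<gamma>s)))"
proof (induction n)
  case 0
  have "{\<gamma>s. set \<gamma>s \<subseteq> {1..d} \<and> length \<gamma>s = 0} = {[]}" by auto
  then show ?case by (simp add: word_Nil)
next
  case (Suc n)
  let ?L = "{\<gamma>s. set \<gamma>s \<subseteq> {1..d} \<and> length \<gamma>s = n}"
  have "(\<Sum>\<gamma>s | set \<gamma>s \<subseteq> {1..d} \<and> length \<gamma>s = Suc n. word (concat (map (\<lambda>\<gamma>. [\<gamma>, \<gamma>]) \<gamma>s)))
      = (\<Sum>(\<gamma>s, \<gamma>)\<in>?L \<times> {1..d}. word (concat (map (\<lambda>\<gamma>. [\<gamma>, \<gamma>]) (\<gamma> # \<gamma>s))))"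
    unfolding lists_length_Suc_eq
    by (subst sum.reindex) (auto simp: inj_on_def split: prod.splits intro!: sum.cong)
  also have "\<dots> = (\<Sum>\<gamma>s\<in>?L. \<Sum>\<gamma>\<in>{1..d}. word [\<gamma>, \<gamma>] * word (concat (map (\<lambda>\<gamma>. [\<gamma>, \<gamma>]) \<gamma>s)))"
    by (subst sum.cartesian_product [symmetric]) (simp add: word_mult)
  also have "\<dots> = (\<Sum>\<gamma>\<in>{1..d}. word [\<gamma>, \<gamma>]) * (\<Sum>\<gamma>s\<in>?L. word (concat (map (\<lambda>\<gamma>. [\<gamma>, \<gamma>]) \<gamma>s)))"
    by (subst sum.swap) (simp add: sum_product)
  finally show ?case by (simp only: power_Suc Suc.IH)
qed

lemma scaleR_power_tensor: "(c *\<^sub>R x) ^ n = c ^ n *\<^sub>R x ^ n" for x :: tensor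
  by (induction n) (simp_all add: mult.commute)

lemma expected_signature_eq:
  "expected_signature d w = suminf (\<lambda>n. 1 / (2 ^ n * fact n) *
     (\<Sum>\<gamma>s | set \<gamma>s \<subseteq> {1..d} \<and> length \<gamma>s = n.
        Poly_Mapping.lookup (word (concat (map (\<lambda>\<gamma>. [\<gamma>, \<gamma>]) \<gamma>s))) w))"
  unfolding expected_signature_def tensor_exp_def
  by (simp only: scaleR_power_tensor lookup_scaleR power_sum_letter_squares lookup_sum)
     (simp add: field_simps)

definition sig_inner :: "nat \<Rightarrow> tensor \<Rightarrow> tensor \<Rightarrow> real" where
  "sig_inner d u v = pairing (shuffle_product u v) (expected_signature d)"

(* sig_inner d is positive definite on tensor_space d, so on the finite-dimensional
   subspaces used below the orthogonal projection exists and is unique. *)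
definition orth_proj :: "('v \<Rightarrow> 'v \<Rightarrow> real) \<Rightarrow> 'v set \<Rightarrow> 'v \<Rightarrow> 'v::real_vector" where
  "orth_proj ip U x = (THE q. q \<in> U \<and> (\<forall>u\<in>U. ip (x - q) u = 0))"

definition block_orth_word :: "nat \<Rightarrow> nat list \<Rightarrow> tensor" where
  "block_orth_word d w =
     word w - orth_proj (sig_inner d) (span (word ` {u \<in> lists {1..d}. length u < length w})) (word w)"

(* H_V for V = R^d. Only its restriction to tensor_space d is meaningful. *)
definition block_orth :: "nat \<Rightarrow> tensor \<Rightarrow> tensor" where
  "block_orth d = lin_ext (block_orth_word d)"

lemma linear_block_orth: "linear (block_orth d)"
  unfolding block_orth_def by (rule linear_lin_ext)

lemma block_orth_on_word: "block_orth d (word w) = block_orth_word d w"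
  by (simp add: block_orth_def)

(* The dimension is quantified over inside the statement, so R^d is the set of real
   sequences (coordinates 1, 2, ...) supported on {1..d}. *)
definition euclid :: "nat \<Rightarrow> vect set" where
  "euclid d = {v. Poly_Mapping.keys v \<subseteq> {1..d}}"

definition euclid_norm :: "vect \<Rightarrow> real" where
  "euclid_norm v = sqrt (\<Sum>i\<in>Poly_Mapping.keys v. (Poly_Mapping.lookup v i)\<^sup>2)"

definition linear_isometry :: "nat \<Rightarrow> nat \<Rightarrow> (vect \<Rightarrow> vect) \<Rightarrow> bool" where
  "linear_isometry m n \<phi> \<longleftrightarrow>
     (\<forall>v\<in>euclid m. \<phi> v \<in> euclid n) \<and>
     (\<forall>v\<in>euclid m. \<forall>w\<in>euclid m. \<phi> (v + w) = \<phi> v + \<phi> w) \<and>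
     (\<forall>c. \<forall>v\<in>euclid m. \<phi> (c *\<^sub>R v) = c *\<^sub>R \<phi> v) \<and>
     (\<forall>v\<in>euclid m. euclid_norm (\<phi> v) = euclid_norm v)"

definition vec_tensor :: "vect \<Rightarrow> tensor" where
  "vec_tensor = lin_ext (\<lambda>i. word [i])"

definition tensor_map :: "(vect \<Rightarrow> vect) \<Rightarrow> tensor \<Rightarrow> tensor" where
  "tensor_map \<phi> = lin_ext (\<lambda>w. prod_list (map (\<lambda>i. vec_tensor (\<phi> (Poly_Mapping.single i 1))) w))"

lemma tensor_map_word:
  "tensor_map \<phi> (word w) = prod_list (map (\<lambda>i. vec_tensor (\<phi> (Poly_Mapping.single i 1))) w)"
  by (simp add: tensor_map_def)

lemma tensor_map_mult: "tensor_map \<phi> (f * g) = tensor_map \<phi> f * tensor_map \<phi> g"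
proof -
  let ?T = "tensor_map \<phi>"
  have lin: "linear ?T"
    unfolding tensor_map_def by (rule linear_lin_ext)
  have *: "f = (\<Sum>k\<in>Poly_Mapping.keys f. Poly_Mapping.lookup f k *\<^sub>R word k)" for f :: tensor
    by (simp add: word_def scaleR_single flip: poly_mapping_eq_sum_single)
  let ?s = "\<lambda>f. \<Sum>k\<in>Poly_Mapping.keys f. Poly_Mapping.lookup f k *\<^sub>R word k"
  have "?T (?s f * ?s g) = ?T (?s f) * ?T (?s g)"
    by (simp add: sum_product linear_sum[OF lin] linear_cmul[OF lin] word_mult tensor_map_word)
  then show ?thesis by (simp flip: *)
qed

lemma tensor_map_vec_tensor:
  assumes "linear_isometry m n \<phi>" "v \<in> euclid m"
  shows "tensor_map \<phi> (vec_tensor v) = vec_tensor (\<phi> v)"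
proof -
  let ?e = "\<lambda>i. Poly_Mapping.single i (1::real)"
  have lin: "linear (tensor_map \<phi>)" "linear vec_tensor"
    unfolding tensor_map_def vec_tensor_def by (rule linear_lin_ext)+
  have add: "\<phi> (v + w) = \<phi> v + \<phi> w" if "v \<in> euclid m" "w \<in> euclid m" for v w
    using assms(1) that by (auto simp: linear_isometry_def)
  have scale: "\<phi> (c *\<^sub>R v) = c *\<^sub>R \<phi> v" if "v \<in> euclid m" for c v
    using assms(1) that by (auto simp: linear_isometry_def)
  have 0: "\<phi> 0 = 0" using scale[of 0 0] by (simp add: euclid_def)
  have e: "?e i \<in> euclid m" if "i \<in> {1..m}" for i using that by (simp add: euclid_def)
  have sum: "(\<Sum>i\<in>A. c i *\<^sub>R ?e i) \<in> euclid m \<and>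
      \<phi> (\<Sum>i\<in>A. c i *\<^sub>R ?e i) = (\<Sum>i\<in>A. c i *\<^sub>R \<phi> (?e i))"
    if "finite A" "A \<subseteq> {1..m}" for A and c :: "nat \<Rightarrow> real"
    using that
  proof (induction A rule: finite_induct)
    case empty
    then show ?case by (simp add: 0 euclid_def)
  next
    case (insert i A)
    have 1: "c i *\<^sub>R ?e i \<in> euclid m" using insert by (auto simp: euclid_def scaleR_single)
    have 2: "(\<Sum>i\<in>A. c i *\<^sub>R ?e i) \<in> euclid m" using insert by auto
    have 3: "c i *\<^sub>R ?e i + (\<Sum>i\<in>A. c i *\<^sub>R ?e i) \<in> euclid m"
      using 1 2 Poly_Mapping.keys_add[of "c i *\<^sub>R ?e i" "\<Sum>i\<in>A. c i *\<^sub>R ?e i"]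
      by (simp add: euclid_def) (meson Un_least subset_trans)
    have 4: "\<phi> (c i *\<^sub>R ?e i) = c i *\<^sub>R \<phi> (?e i)"
      using scale[OF e, of i "c i"] insert.prems by blast
    show ?case using insert.hyps insert.IH insert.prems 3 4 add[OF 1 2] by simp
  qed
  have v: "v = (\<Sum>i\<in>Poly_Mapping.keys v. Poly_Mapping.lookup v i *\<^sub>R ?e i)"
    by (simp add: scaleR_single flip: poly_mapping_eq_sum_single)
  have "\<phi> v = (\<Sum>i\<in>Poly_Mapping.keys v. Poly_Mapping.lookup v i *\<^sub>R \<phi> (?e i))"
    using sum[of "Poly_Mapping.keys v" "Poly_Mapping.lookup v"] assms(2)
    unfolding v[symmetric] by (simp add: euclid_def)
  then have "vec_tensor (\<phi> v) = (\<Sum>i\<in>Poly_Mapping.keys v. Poly_Mapping.lookup v i *\<^sub>R vec_tensor (\<phi> (?e i)))"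
    by (simp add: linear_sum[OF lin(2)] linear_cmul[OF lin(2)])
  also have "\<dots> = tensor_map \<phi> (vec_tensor v)"
    by (simp add: vec_tensor_def[THEN fun_cong, of v] lin_ext_def[of _ v]
        linear_sum[OF lin(1)] linear_cmul[OF lin(1)] tensor_map_word)
  finally show ?thesis by simp
qed

lemma tensor_map_prod_vectors:
  assumes "linear_isometry m n \<phi>" "set vs \<subseteq> euclid m"
  shows "tensor_map \<phi> (prod_list (map vec_tensor vs)) = prod_list (map (\<lambda>v. vec_tensor (\<phi> v)) vs)"
  using assms(2)
proof (induction vs)
  case Nil
  then show ?case by (simp add: tensor_map_word flip: word_Nil)
next
  case (Cons v vs)
  then show ?case by (simp add: tensor_map_mult tensor_map_vec_tensor[OF assms(1)])
qed

(* H d is regarded as a map on tensor_space d, for d ranging over D, and the Euclidean spaces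
   and isometries are those between the R^d with d in D. *)
definition natural_family :: "nat set \<Rightarrow> (nat \<Rightarrow> tensor \<Rightarrow> tensor) \<Rightarrow> bool" where
  "natural_family D H \<longleftrightarrow>
     (\<forall>m\<in>D. \<forall>n\<in>D. \<forall>\<phi>. linear_isometry m n \<phi> \<and> inj_on \<phi> (euclid m) \<longrightarrow>
        (\<forall>x\<in>tensor_space m. tensor_map \<phi> (H m x) = H n (tensor_map \<phi> x)))"

end

theory Submission
  imports Defs
begin

text \<open>
  Naturality already fails for the inclusion of \<open>\<real>\<^sup>2\<close> into \<open>\<real>\<^sup>3\<close>, whose induced map on tensors does
  not change words. Let \<open>w = 11221\<close>. If the family were natural, the projections \<open>q\<close> of \<open>w\<close> computed
  in dimensions 2 and 3 would be the same tensor: a combination of words of length at most 4 in the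
  letters 1 and 2, with \<open>w - q\<close> orthogonal to all words of length at most 4 in the letters 1, 2, 3.
  The tensor \<open>z = 5 (133 - 331) - (122 - 221)\<close> is orthogonal to every word of length at most 4 in the
  letters 1 and 2 (\<open>witness_orthogonal_short_word\<close>), so it is orthogonal to \<open>q\<close> and hence to
  \<open>w = (w - q) + q\<close>. But the inner product of \<open>w\<close> and \<open>z\<close> is \<open>-1/48\<close>
  (\<open>sig_inner_word_witness\<close>).

  The projections are defined by a unique description, so this argument needs the form
  \<open>B = sig_inner d\<close> to be positive definite (\<open>sig_inner_pos\<close>). The coefficients of the expected
  signature satisfy \<open>E(abw) = [a = b] E(w) / (length w + 2)\<close>. Together with the recursion of the
  shuffle product this gives, for the degree operator \<open>D\<close>, the contraction \<open>P\<close> of two equal leading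
  letters and the removal \<open>\<partial>\<^sub>a\<close> of a leading letter \<open>a\<close>, the identity (\<open>lyapunov_identity\<close>)

  \<open>B((D - P) f, g) + B(f, (D - P) g) = 2 \<Sum>\<^sub>a B(\<partial>\<^sub>a f, \<partial>\<^sub>a g)\<close>.

  It is the algebraic form of the evolution in time of the second moment of a linear functional of
  the signature. The operator \<open>D - P\<close> is diagonalisable: the eigentensor \<open>exp(-P/2) w\<close> has
  eigenvalue \<open>length w\<close>, and eigentensors span. Write \<open>f\<close> as a combination of eigentensors, let
  \<open>F(s)\<close> be the same combination with the term of eigenvalue \<open>k\<close> multiplied by \<open>s\<^sup>k\<close>, and let
  \<open>h(s) = B(F(s), F(s))\<close>. Then \<open>s h'(s) = 2 \<Sum>\<^sub>a B(\<partial>\<^sub>a F(s), \<partial>\<^sub>a F(s))\<close>, which by induction on the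
  degree is nonnegative for all \<open>s\<close>, and positive at \<open>s = 1\<close> unless \<open>f = F(1)\<close> is constant. As
  \<open>h(0)\<close> is a square, \<open>h(1) = B(f, f)\<close> is positive; for constant \<open>f \<noteq> 0\<close> this is clear.
\<close>

section \<open>The expected signature\<close>

text \<open>The word \<open>\<gamma>\<^sub>1\<gamma>\<^sub>1\<dots>\<gamma>\<^sub>n\<gamma>\<^sub>n\<close>.\<close>

definition doubled :: "nat list \<Rightarrow> nat list" where
  "doubled \<gamma>s = concat (map (\<lambda>\<gamma>. [\<gamma>, \<gamma>]) \<gamma>s)"

lemma doubled_simps [simp]:
  "doubled [] = []" "doubled (\<gamma> # \<gamma>s) = \<gamma> # \<gamma> # doubled \<gamma>s"
  by (simp_all add: doubled_def)

lemma length_doubled [simp]: "length (doubled \<gamma>s) = 2 * length \<gamma>s"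
  by (induction \<gamma>s) auto

text \<open>
  The coefficient of the word \<open>w\<close> in the sum of all \<open>\<gamma>\<^sub>1\<gamma>\<^sub>1\<dots>\<gamma>\<^sub>n\<gamma>\<^sub>n\<close> with letters in \<open>{1..d}\<close>; it is 0 or 1.
\<close>

definition doubling_count :: "nat \<Rightarrow> nat \<Rightarrow> nat list \<Rightarrow> real" where
  "doubling_count d n w =
     (\<Sum>\<gamma>s | set \<gamma>s \<subseteq> {1..d} \<and> length \<gamma>s = n. if doubled \<gamma>s = w then 1 else 0)"

lemma doubling_count_eq_0: "length w \<noteq> 2 * n \<Longrightarrow> doubling_count d n w = 0"
  unfolding doubling_count_def by (rule sum.neutral) auto

lemma doubling_count_0 [simp]: "doubling_count d 0 w = (if w = [] then 1 else 0)"
proof -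
  have "{\<gamma>s. set \<gamma>s \<subseteq> {1..d} \<and> length \<gamma>s = 0} = {[]}" by auto
  then show ?thesis by (simp add: doubling_count_def)
qed

lemma doubling_count_Suc:
  "doubling_count d (Suc n) (a # b # w) =
     (if a = b \<and> a \<in> {1..d} then doubling_count d n w else 0)"
proof -
  let ?L = "{\<gamma>s. set \<gamma>s \<subseteq> {1..d} \<and> length \<gamma>s = n}"
  have "doubling_count d (Suc n) (a # b # w) =
      (\<Sum>(\<gamma>s, \<gamma>)\<in>?L \<times> {1..d}. if doubled (\<gamma> # \<gamma>s) = a # b # w then 1 else 0)"
    unfolding doubling_count_def lists_length_Suc_eq
    by (subst sum.reindex) (auto simp: inj_on_def split: prod.splits intro!: sum.cong)
  also have "\<dots> = (\<Sum>\<gamma>s\<in>?L. \<Sum>\<gamma>\<in>{1..d}.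
      if \<gamma> = a then (if a = b \<and> doubled \<gamma>s = w then 1 else 0) else 0)"
    by (subst sum.cartesian_product [symmetric], intro sum.cong) auto
  also have "\<dots> = (if a = b \<and> a \<in> {1..d} then doubling_count d n w else 0)"
    by (simp only: sum.delta finite_atLeastAtMost) (auto simp: doubling_count_def intro!: sum.neutral)
  finally show ?thesis .
qed

lemma expected_signature_doubling_count:
  "expected_signature d w =
     (if even (length w)
      then doubling_count d (length w div 2) w / (2 ^ (length w div 2) * fact (length w div 2))
      else 0)"
proof -
  let ?f = "\<lambda>n. doubling_count d n w / (2 ^ n * fact n)"
  have es: "expected_signature d w = suminf ?f"
    unfolding expected_signature_eq
    by (rule arg_cong[where f = suminf], rule ext)
       (simp add: doubling_count_def word_def lookup_single when_def flip: doubled_def)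
  show ?thesis
  proof (cases "even (length w)")
    case True
    have "?f n = (if n = length w div 2 then ?f n else 0)" for n
      using doubling_count_eq_0[of w n d] True by auto
    then have "?f sums ?f (length w div 2)"
      using sums_single[of "length w div 2" ?f] by presburger
    then show ?thesis using True unfolding es by (simp add: sums_unique[symmetric])
  next
    case False
    then have "doubling_count d n w = 0" for n
      by (intro doubling_count_eq_0) auto
    then show ?thesis using False unfolding es by simp
  qed
qed

text \<open>Reading a word two letters at a time determines the expected signature.\<close>

lemma expected_signature_simps [simp]:
  "expected_signature d [] = 1"
  "expected_signature d [a] = 0"
  "expected_signature d (a # b # w) =
     (if a = b \<and> a \<in> {1..d} then expected_signature d w / real (length w + 2) else 0)"
proof -
  show "expected_signature d [] = 1" "expected_signature d [a] = 0"
    by (simp_all add: expected_signature_doubling_count)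
  show "expected_signature d (a # b # w) =
     (if a = b \<and> a \<in> {1..d} then expected_signature d w / real (length w + 2) else 0)"
  proof (cases "even (length w)")
    case True
    then obtain n where n: "length w = 2 * n" by (auto elim: evenE)
    then show ?thesis
      by (simp add: expected_signature_doubling_count doubling_count_Suc field_simps)
  next
    case False
    then show ?thesis by (simp add: expected_signature_doubling_count)
  qed
qed

section \<open>The signature inner product as a symmetric bilinear form\<close>

lemma linear_lin_ext_apply:
  assumes "\<And>a. linear (\<lambda>g. h g a)"
  shows "linear (\<lambda>g. lin_ext (h g) f)"
  unfolding lin_ext_def
  by (intro linear_compose_sum ballI linear_compose_scale_right assms)

lemma linear_expand_lin_ext:
  assumes "linear F"
  shows "F f = lin_ext (\<lambda>w. F (word w)) f"
proof -
  have "f = (\<Sum>k\<in>Poly_Mapping.keys f. Poly_Mapping.lookup f k *\<^sub>R word k)"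
    by (simp add: word_def scaleR_single flip: poly_mapping_eq_sum_single)
  then have "F f = F (\<Sum>k\<in>Poly_Mapping.keys f. Poly_Mapping.lookup f k *\<^sub>R word k)" by simp
  then show ?thesis
    by (simp add: lin_ext_def linear_sum[OF assms] linear_cmul[OF assms])
qed

lemma linear_eq_on_words:
  assumes "linear F" "linear G" "\<And>w. F (word w) = G (word w)"
  shows "F f = G f"
  using linear_expand_lin_ext[OF assms(1), of f] linear_expand_lin_ext[OF assms(2), of f] assms(3)
  by simp

lemma linear_sig_inner_left: "linear (\<lambda>f. sig_inner d f g)"
  unfolding sig_inner_def pairing_def shuffle_product_def
  using linear_compose[OF linear_lin_ext linear_lin_ext] by (simp add: o_def)

lemma linear_sig_inner_right: "linear (sig_inner d f)"
  unfolding sig_inner_def pairing_def shuffle_product_def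
  by (rule linear_compose[OF linear_lin_ext_apply linear_lin_ext, unfolded o_def])
     (rule linear_lin_ext)

lemma sig_inner_word:
  "sig_inner d (word u) (word v) = (\<Sum>w\<in>#shuffle_words u v. expected_signature d w)"
proof -
  have "lin_ext h (\<Sum>w\<in>#M. word w) = (\<Sum>w\<in>#M. h w)" for h :: "nat list \<Rightarrow> real" and M
    by (induction M) (simp_all add: linear_add[OF linear_lin_ext] linear_0[OF linear_lin_ext])
  then show ?thesis by (simp add: sig_inner_def pairing_def shuffle_product_def)
qed

lemma shuffle_words_Nil_right [simp]: "shuffle_words u [] = {#u#}"
  by (cases u) auto

lemma shuffle_words_commute: "shuffle_words u v = shuffle_words v u"
  by (induction u v rule: shuffle_words.induct) (auto simp: add.commute)

lemma sig_inner_commute: "sig_inner d f g = sig_inner d g f"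
proof (rule linear_eq_on_words[where f = f, OF linear_sig_inner_left linear_sig_inner_right])
  fix u
  show "sig_inner d (word u) g = sig_inner d g (word u)"
    by (rule linear_eq_on_words[where f = g, OF linear_sig_inner_right linear_sig_inner_left])
       (simp add: sig_inner_word shuffle_words_commute)
qed

lemmas sig_inner_left_simps =
  linear_add[OF linear_sig_inner_left] linear_diff[OF linear_sig_inner_left]
  linear_cmul[OF linear_sig_inner_left] linear_0[OF linear_sig_inner_left]
  linear_sum[OF linear_sig_inner_left]

lemmas sig_inner_right_simps =
  linear_add[OF linear_sig_inner_right] linear_diff[OF linear_sig_inner_right]
  linear_cmul[OF linear_sig_inner_right] linear_0[OF linear_sig_inner_right]
  linear_sum[OF linear_sig_inner_right]

lemma length_shuffle_words: "x \<in># shuffle_words u v \<Longrightarrow> length x = length u + length v"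
  by (induction u v arbitrary: x rule: shuffle_words.induct) auto

section \<open>The Lyapunov identity\<close>

text \<open>
  The operator \<open>\<partial>\<^sub>a\<close> on words: it deletes the leading letter if this is \<open>a\<close>, and gives 0 otherwise.
\<close>

definition remove_letter :: "nat \<Rightarrow> nat list \<Rightarrow> tensor" where
  "remove_letter a w = (case w of [] \<Rightarrow> 0 | b # u \<Rightarrow> if b = a then word u else 0)"

text \<open>
  The operator \<open>P\<close> on words: it deletes the two leading letters if they are equal, and gives 0
  otherwise. It is written through \<open>remove_letter\<close>, the form in which it comes out of the shuffle
  recursion.
\<close>

definition contract_word :: "nat list \<Rightarrow> tensor" where
  "contract_word w = (case w of a # u \<Rightarrow> remove_letter a u | [] \<Rightarrow> 0)"

lemma remove_letter_simps [simp]: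
  "remove_letter a [] = 0"
  "remove_letter a (b # u) = (if b = a then word u else 0)"
  by (simp_all add: remove_letter_def)

lemma contract_word_simps [simp]:
  "contract_word [] = 0"
  "contract_word (a # u) = remove_letter a u"
  by (simp_all add: contract_word_def)

text \<open>
  In a word \<open>a # x\<close>, where \<open>x\<close> is a shuffle of \<open>u\<close> and \<open>v\<close>, the leading letter \<open>a\<close> can only be paired
  with the first letter of \<open>x\<close>, and this is the first letter of \<open>u\<close> or of \<open>v\<close>.
\<close>

lemma sum_expected_signature_Cons:
  assumes "a \<in> {1..d}"
  shows "real (length u + length v + 1) * (\<Sum>x\<in>#shuffle_words u v. expected_signature d (a # x)) =
    sig_inner d (remove_letter a u) (word v) + sig_inner d (word u) (remove_letter a v)"
proof -
  have *: "(\<Sum>x\<in>#M. expected_signature d (a # b # x)) =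
      (if b = a then (\<Sum>x\<in>#M. expected_signature d x) / real (n + 2) else 0)"
    if "\<And>x. x \<in># M \<Longrightarrow> length x = n" for b n M
    using that assms by (induction M) (auto simp: add_divide_distrib)
  show ?thesis
  proof (cases u; cases v)
    fix b u' c v' assume [simp]: "u = b # u'" "v = c # v'"
    let ?m = "real (length u + length v + 1)"
    have "?m * (\<Sum>x\<in>#shuffle_words u' v. expected_signature d (a # b # x)) =
        (if b = a then sig_inner d (word u') (word v) else 0)"
      by (subst *[where n = "length u' + length v"])
        (auto dest: length_shuffle_words simp: sig_inner_word)
    moreover have "?m * (\<Sum>x\<in>#shuffle_words u v'. expected_signature d (a # c # x)) =
        (if c = a then sig_inner d (word u) (word v') else 0)"
      by (subst *[where n = "length u + length v'"])
        (auto dest: length_shuffle_words simp: sig_inner_word)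
    moreover have "(\<Sum>x\<in>#shuffle_words u v. expected_signature d (a # x)) =
        (\<Sum>x\<in>#shuffle_words u' v. expected_signature d (a # b # x)) +
        (\<Sum>x\<in>#shuffle_words u v'. expected_signature d (a # c # x))"
      by (simp add: image_mset.compositionality o_def)
    ultimately show ?thesis
      by (simp only: distrib_left)
         (simp add: sig_inner_left_simps sig_inner_right_simps)
  qed (use assms in \<open>auto simp: sig_inner_word sig_inner_left_simps sig_inner_right_simps\<close>)
qed

lemma sig_inner_word_Cons:
  assumes "a \<in> {1..d}" "b \<in> {1..d}"
  shows "real (length u + length v + 2) * sig_inner d (word (a # u)) (word (b # v)) =
    sig_inner d (contract_word (a # u)) (word (b # v)) +
    sig_inner d (word (a # u)) (contract_word (b # v)) +
    2 * (if a = b then sig_inner d (word u) (word v) else 0)"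
proof -
  have "sig_inner d (word (a # u)) (word (b # v)) =
      (\<Sum>x\<in>#shuffle_words u (b # v). expected_signature d (a # x)) +
      (\<Sum>x\<in>#shuffle_words (a # u) v. expected_signature d (b # x))"
    by (simp add: sig_inner_word image_mset.compositionality o_def)
  then show ?thesis
    using sum_expected_signature_Cons[OF assms(1), of u "b # v"]
      sum_expected_signature_Cons[OF assms(2), of "a # u" v]
    by (auto simp: distrib_left sig_inner_left_simps sig_inner_right_simps)
qed

lemma sig_inner_Nil_word:
  assumes "set v \<subseteq> {1..d}"
  shows "real (length v) * sig_inner d (word []) (word v) = sig_inner d (word []) (contract_word v)"
  using assms
  by (cases v rule: remdups_adj.cases) (auto simp: sig_inner_word sig_inner_right_simps)

lemma lyapunov_words:
  assumes "set u \<subseteq> {1..d}" "set v \<subseteq> {1..d}"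
  shows "real (length u + length v) * sig_inner d (word u) (word v) =
    sig_inner d (contract_word u) (word v) + sig_inner d (word u) (contract_word v) +
    2 * (\<Sum>a\<in>{1..d}. sig_inner d (remove_letter a u) (remove_letter a v))"
proof (cases u)
  case Nil
  then show ?thesis using sig_inner_Nil_word[OF assms(2)] by (simp add: sig_inner_left_simps)
next
  case (Cons a u')
  show ?thesis
  proof (cases v)
    case Nil
    then show ?thesis
      using sig_inner_Nil_word[OF assms(1)]
      by (simp add: sig_inner_right_simps sig_inner_commute[of _ _ "word []"])
  next
    case (Cons b v')
    have "(\<Sum>c\<in>{1..d}. sig_inner d (remove_letter c u) (remove_letter c v)) =
        (\<Sum>c\<in>{1..d}. if c = a then (if a = b then sig_inner d (word u') (word v') else 0) else 0)"
      by (intro sum.cong)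
        (auto simp: Cons \<open>u = a # u'\<close> sig_inner_left_simps sig_inner_right_simps)
    also have "\<dots> = (if a = b then sig_inner d (word u') (word v') else 0)"
      using assms \<open>u = a # u'\<close> by (auto simp: sum.delta)
    finally have *: "(\<Sum>c\<in>{1..d}. sig_inner d (remove_letter c u) (remove_letter c v)) =
        (if a = b then sig_inner d (word u') (word v') else 0)" .
    show ?thesis unfolding *
      using sig_inner_word_Cons[of a d b u' v'] assms \<open>u = a # u'\<close> Cons by simp
  qed
qed

text \<open>The linear operators \<open>P\<close>, \<open>\<partial>\<^sub>a\<close> and \<open>D\<close> on tensors.\<close>

definition contraction :: "tensor \<Rightarrow> tensor" where
  "contraction = lin_ext contract_word"

definition letter_derivative :: "nat \<Rightarrow> tensor \<Rightarrow> tensor" where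
  "letter_derivative a = lin_ext (remove_letter a)"

definition degree_operator :: "tensor \<Rightarrow> tensor" where
  "degree_operator = lin_ext (\<lambda>w. real (length w) *\<^sub>R word w)"

lemma linear_operators:
  "linear contraction" "linear (letter_derivative a)" "linear degree_operator"
  by (simp_all add: contraction_def letter_derivative_def degree_operator_def linear_lin_ext)

lemmas linear_operators_simps =
  linear_operators[THEN linear_add] linear_operators[THEN linear_diff]
  linear_operators[THEN linear_cmul] linear_operators[THEN linear_0]
  linear_operators[THEN linear_sum]

lemma operators_word [simp]:
  "contraction (word w) = contract_word w"
  "letter_derivative a (word w) = remove_letter a w"
  "degree_operator (word w) = real (length w) *\<^sub>R word w"
  by (simp_all add: contraction_def letter_derivative_def degree_operator_def)

lemma lyapunov_identity:
  assumes "f \<in> tensor_space d" "g \<in> tensor_space d"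
  shows "sig_inner d (degree_operator f - contraction f) g +
      sig_inner d f (degree_operator g - contraction g) =
    2 * (\<Sum>a\<in>{1..d}. sig_inner d (letter_derivative a f) (letter_derivative a g))"
    (is "?l f g = ?r f g")
proof -
  have "?l (word u) (word v) = ?r (word u) (word v)"
    if "u \<in> lists {1..d}" "v \<in> lists {1..d}" for u v
    using lyapunov_words[of u d v] that
    by (simp add: in_lists_conv_set subset_iff sig_inner_left_simps sig_inner_right_simps algebra_simps)
  moreover have "linear (?l f)" "linear (?r f)" for f
    by (rule linearI; simp add: sig_inner_left_simps sig_inner_right_simps
        linear_operators_simps algebra_simps sum.distrib sum_distrib_left)+
  ultimately have "?l (word u) g = ?r (word u) g" if "u \<in> lists {1..d}" for u
    using linear_eq_on_span[of "?l (word u)" "?r (word u)" "word ` lists {1..d}" g] that assms(2)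
    unfolding tensor_space_def by blast
  moreover have "linear (\<lambda>f. ?l f g)" "linear (\<lambda>f. ?r f g)"
    by (rule linearI; simp add: sig_inner_left_simps sig_inner_right_simps
        linear_operators_simps algebra_simps sum.distrib sum_distrib_left)+
  ultimately show ?thesis
    using linear_eq_on_span[of "\<lambda>f. ?l f g" "\<lambda>f. ?r f g" "word ` lists {1..d}" f] assms(1)
    unfolding tensor_space_def by blast
qed

section \<open>Eigentensors\<close>

lemma contract_word_cases:
  obtains "contract_word w = 0" | a u where "w = a # a # u" "contract_word w = word u"
proof (cases "contract_word w = 0")
  case False
  then have "\<exists>a u. w = a # a # u \<and> contract_word w = word u"
    by (cases w rule: remdups_adj.cases) (auto split: if_splits)
  then show thesis using that(2) by blast
qed (rule that(1))

text \<open>Contraction lowers the degree by 2: \<open>D P = P D - 2 P\<close>.\<close>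

lemma degree_operator_contraction:
  "degree_operator (contraction f) = contraction (degree_operator f) - 2 *\<^sub>R contraction f"
proof (rule linear_eq_on_words[where f = f])
  show "degree_operator (contraction (word w)) =
      contraction (degree_operator (word w)) - 2 *\<^sub>R contraction (word w)" for w
    by (rule contract_word_cases[of w])
       (auto simp: linear_operators_simps algebra_simps)
qed (rule linearI; simp add: linear_operators_simps algebra_simps)+

lemma degree_operator_contraction_funpow:
  "degree_operator ((contraction ^^ k) (word w)) =
     (real (length w) - 2 * real k) *\<^sub>R (contraction ^^ k) (word w)"
proof (induction k)
  case (Suc k)
  have "real (length w) - 2 * real (Suc k) = (real (length w) - 2 * real k) - 2" by simp
  with Suc show ?case
    by (simp only: funpow.simps o_apply degree_operator_contraction
        linear_cmul[OF linear_operators(1)] scaleR_left_diff_distrib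
        linear_diff[OF linear_operators(1)])
qed simp

lemma contraction_funpow_0 [simp]: "(contraction ^^ k) 0 = 0"
  by (induction k) (simp_all add: linear_operators_simps)

lemma contraction_funpow_eq_0: "length w < k \<Longrightarrow> (contraction ^^ k) (word w) = 0"
proof (induction k arbitrary: w)
  case (Suc k)
  show ?case
    by (rule contract_word_cases[of w]) (use Suc in \<open>auto simp: funpow_Suc_right simp del: funpow.simps\<close>)
qed simp

text \<open>
  The tensor \<open>exp(-P/2) w\<close>. The sum may stop at \<open>k = length w\<close>, since higher powers of \<open>P\<close> annihilate
  \<open>w\<close>.
\<close>

definition eigentensor :: "nat list \<Rightarrow> tensor" where
  "eigentensor w = (\<Sum>k\<le>length w. ((- 1 / 2) ^ k / fact k) *\<^sub>R (contraction ^^ k) (word w))"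

lemma eigentensor_eigenvector:
  "degree_operator (eigentensor w) - contraction (eigentensor w) =
     real (length w) *\<^sub>R eigentensor w"
proof -
  let ?N = "length w" and ?Q = "\<lambda>k. (contraction ^^ k) (word w)"
  let ?\<alpha> = "\<lambda>k. (- 1 / 2) ^ k / fact k :: real"
  let ?f = "\<lambda>k. (- 2 * real k * ?\<alpha> k) *\<^sub>R ?Q k"
  have "degree_operator (eigentensor w) =
      (\<Sum>k\<le>?N. (real ?N * ?\<alpha> k) *\<^sub>R ?Q k + ?f k)"
    unfolding eigentensor_def
    by (simp add: linear_operators_simps degree_operator_contraction_funpow algebra_simps)
  also have "\<dots> = real ?N *\<^sub>R eigentensor w + (\<Sum>k\<le>?N. ?f k)"
    by (simp add: sum.distrib sum_subtractf sum_negf eigentensor_def scaleR_sum_right)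
  \<comment> \<open>The coefficients satisfy \<open>- 2 (k + 1) \<alpha>\<^sub>k\<^sub>+\<^sub>1 = \<alpha>\<^sub>k\<close>, so an index shift turns this sum into \<open>P\<close>
     applied to the eigentensor.\<close>
  also have "(\<Sum>k\<le>?N. ?f k) = (\<Sum>k\<le>Suc ?N. ?f k)"
    using contraction_funpow_eq_0[of w "Suc ?N"] by simp
  also have "\<dots> = (\<Sum>k\<le>?N. ?f (Suc k))"
    by (subst sum.atMost_Suc_shift) simp
  also have "\<dots> = (\<Sum>k\<le>?N. ?\<alpha> k *\<^sub>R ?Q (Suc k))"
    by (intro sum.cong refl) (simp add: field_simps del: of_nat_Suc)
  also have "\<dots> = contraction (eigentensor w)"
    by (simp add: eigentensor_def linear_operators_simps)
  finally show ?thesis by simp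
qed

text \<open>
  The span of the words over \<open>{1..d}\<close> of length strictly less than \<open>n\<close>, the space onto which words of
  length \<open>n\<close> are projected.
\<close>

definition tensors_below :: "nat \<Rightarrow> nat \<Rightarrow> tensor set" where
  "tensors_below d n = span (word ` {u \<in> lists {1..d}. length u < n})"

lemma subspace_tensors_below: "subspace (tensors_below d n)"
  by (simp add: tensors_below_def)

lemma word_in_tensors_below: "u \<in> lists {1..d} \<Longrightarrow> length u < n \<Longrightarrow> word u \<in> tensors_below d n"
  unfolding tensors_below_def by (rule span_base) auto

lemma tensors_below_mono: "m \<le> n \<Longrightarrow> tensors_below d m \<subseteq> tensors_below d n"
  unfolding tensors_below_def by (intro span_mono) auto

lemma tensors_below_subset_tensor_space: "tensors_below d n \<subseteq> tensor_space d"
  unfolding tensors_below_def tensor_space_def by (intro span_mono) auto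

lemma finite_words_below: "finite {u \<in> lists {1..d::nat}. length u < n}"
proof -
  have "{u \<in> lists {1..d}. length u < n} \<subseteq> {u. set u \<subseteq> {1..d} \<and> length u \<le> n}"
    by auto
  then show ?thesis by (rule finite_subset) (rule finite_lists_length_le[OF finite_atLeastAtMost])
qed

lemma linear_maps_tensors_below:
  assumes "linear F" "f \<in> tensors_below d m"
    and "\<And>u. u \<in> lists {1..d} \<Longrightarrow> length u < m \<Longrightarrow> F (word u) \<in> tensors_below d n"
  shows "F f \<in> tensors_below d n"
proof -
  have "F f \<in> F ` tensors_below d m" using assms(2) by blast
  also have "\<dots> = span (F ` word ` {u \<in> lists {1..d}. length u < m})"
    unfolding tensors_below_def using linear_span_image[OF assms(1)] by metis
  also have "\<dots> \<subseteq> tensors_below d n"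
    by (rule span_minimal) (use assms(3) subspace_tensors_below in auto)
  finally show ?thesis .
qed

lemma contract_word_in_tensors_below:
  "w \<in> lists {1..d} \<Longrightarrow> contract_word w \<in> tensors_below d (length w)"
  by (rule contract_word_cases[of w])
     (auto intro: word_in_tensors_below simp: subspace_0 subspace_tensors_below)

lemma contraction_in_tensors_below:
  assumes "f \<in> tensors_below d n"
  shows "contraction f \<in> tensors_below d n"
  by (rule linear_maps_tensors_below[OF linear_operators(1) assms])
     (use contract_word_in_tensors_below tensors_below_mono[OF less_imp_le] in fastforce)

lemma contraction_funpow_Suc_in_tensors_below:
  assumes "w \<in> lists {1..d}"
  shows "(contraction ^^ Suc k) (word w) \<in> tensors_below d (length w)"
proof (induction k)
  case 0
  then show ?case using contract_word_in_tensors_below[OF assms] by simp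
next
  case (Suc k)
  then show ?case using contraction_in_tensors_below by simp
qed

text \<open>
  The change from words to eigentensors is unitriangular with respect to length, hence invertible.
\<close>

lemma eigentensor_minus_word:
  assumes "w \<in> lists {1..d}"
  shows "eigentensor w - word w \<in> tensors_below d (length w)"
proof -
  have "eigentensor w - word w =
      (\<Sum>k<length w. ((- 1 / 2) ^ Suc k / fact (Suc k)) *\<^sub>R (contraction ^^ Suc k) (word w))"
    unfolding eigentensor_def sum.atMost_shift by simp
  also have "\<dots> \<in> tensors_below d (length w)"
    by (intro subspace_sum subspace_scale subspace_tensors_below
        contraction_funpow_Suc_in_tensors_below assms)
  finally show ?thesis .
qed

lemma eigentensor_in_tensors_below:
  assumes "w \<in> lists {1..d}" "length w < n"
  shows "eigentensor w \<in> tensors_below d n"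
proof -
  have "eigentensor w - word w \<in> tensors_below d n"
    using eigentensor_minus_word[OF assms(1)] tensors_below_mono[of "length w" n d] assms(2) by auto
  from subspace_add[OF subspace_tensors_below this word_in_tensors_below[OF assms]]
  show ?thesis by simp
qed

lemma tensors_below_subset_span_eigentensors:
  "tensors_below d n \<subseteq> span (eigentensor ` {u \<in> lists {1..d}. length u < n})"
proof (induction n)
  case 0
  then show ?case by (simp add: tensors_below_def)
next
  case (Suc n)
  let ?E = "\<lambda>n. span (eigentensor ` {u \<in> lists {1..d}. length u < n})"
  have mono: "?E n \<subseteq> ?E (Suc n)" by (intro span_mono) auto
  have "word w \<in> ?E (Suc n)" if w: "w \<in> lists {1..d}" "length w < Suc n" for w
  proof -
    have "eigentensor w - word w \<in> ?E (Suc n)"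
      using eigentensor_minus_word[OF w(1)] tensors_below_mono[of "length w" n d] w(2) Suc mono
      by (meson less_Suc_eq_le subsetD)
    moreover have "eigentensor w \<in> ?E (Suc n)" using w by (auto intro: span_base)
    ultimately show ?thesis using span_diff by fastforce
  qed
  then show ?case unfolding tensors_below_def by (intro span_minimal) auto
qed

lemma span_image_finite_expansion:
  fixes h :: "'a \<Rightarrow> 'v::real_vector"
  assumes "finite A" "x \<in> span (h ` A)"
  obtains c where "x = (\<Sum>a\<in>A. c a *\<^sub>R h a)"
proof -
  let ?R = "range (\<lambda>c. \<Sum>a\<in>A. c a *\<^sub>R h a)"
  have "subspace ?R"
  proof (rule subspaceI)
    show "0 \<in> ?R" by (rule range_eqI[of _ _ "\<lambda>_. 0"]) simp
    fix x y and r :: real assume "x \<in> ?R" "y \<in> ?R"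
    then obtain c c' where c: "x = (\<Sum>a\<in>A. c a *\<^sub>R h a)" "y = (\<Sum>a\<in>A. c' a *\<^sub>R h a)" by blast
    show "x + y \<in> ?R"
      by (rule range_eqI[of _ _ "\<lambda>a. c a + c' a"]) (simp add: c scaleR_add_left sum.distrib)
    show "r *\<^sub>R x \<in> ?R"
      by (rule range_eqI[of _ _ "\<lambda>a. r * c a"]) (simp add: c scaleR_sum_right)
  qed
  moreover have "h ` A \<subseteq> ?R"
  proof (rule image_subsetI)
    fix b assume "b \<in> A"
    then show "h b \<in> ?R"
      using assms(1)
      by (intro range_eqI[of _ _ "\<lambda>a. if a = b then 1 else 0"]) (simp add: if_distrib[of "\<lambda>c. c *\<^sub>R _"] sum.delta cong: if_cong)
  qed
  ultimately have "x \<in> ?R" using assms(2) span_minimal by blast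
  then show ?thesis using that by blast
qed

section \<open>Positive definiteness\<close>

lemma letter_derivative_in_tensors_below:
  assumes "f \<in> tensors_below d (Suc n)"
  shows "letter_derivative a f \<in> tensors_below d n"
proof (rule linear_maps_tensors_below[OF linear_operators(2) assms])
  fix u assume "u \<in> lists {1..d}" "length u < Suc n"
  then show "letter_derivative a (word u) \<in> tensors_below d n"
    by (cases u) (auto intro: word_in_tensors_below simp: subspace_0 subspace_tensors_below)
qed

text \<open>In particular, a tensor is constant if all its letter derivatives vanish.\<close>

lemma tensor_eq_sum_letter_derivatives:
  assumes "f \<in> tensor_space d"
  shows "f = Poly_Mapping.lookup f [] *\<^sub>R word [] +
    (\<Sum>a\<in>{1..d}. word [a] * letter_derivative a f)"
proof (rule linear_eq_on_span[where f = "\<lambda>f. f"])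
  show "f \<in> span (word ` lists {1..d})" using assms by (simp add: tensor_space_def)
  show "linear (\<lambda>f. Poly_Mapping.lookup f [] *\<^sub>R word [] +
      (\<Sum>a\<in>{1..d}. word [a] * letter_derivative a f))"
    by (rule linearI)
       (simp_all add: lookup_add linear_operators_simps algebra_simps sum.distrib scaleR_sum_right)
  fix x assume "x \<in> word ` lists {1..d}"
  then obtain w where w: "x = word w" "w \<in> lists {1..d}" by blast
  show "x = Poly_Mapping.lookup x [] *\<^sub>R word [] +
      (\<Sum>a\<in>{1..d}. word [a] * letter_derivative a x)"
  proof (cases w)
    case Nil
    then show ?thesis by (simp add: w(1)) (simp add: word_def)
  next
    case (Cons b u)
    have "(\<Sum>a\<in>{1..d}. word [a] * letter_derivative a x) =
        (\<Sum>a\<in>{1..d}. if a = b then word (b # u) else 0)"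
      by (intro sum.cong) (auto simp: w(1) Cons word_mult)
    also have "\<dots> = x" using w Cons by (simp add: sum.delta)
    finally show ?thesis using w(1) Cons by (simp add: word_def lookup_single)
  qed
qed (rule linear_ident)

lemma sig_inner_pos:
  assumes "f \<in> tensors_below d n" "f \<noteq> 0"
  shows "sig_inner d f f > 0"
  using assms
proof (induction n arbitrary: f)
  case 0
  then show ?case by (simp add: tensors_below_def)
next
  case (Suc n)
  have nonneg: "sig_inner d x x \<ge> 0" if "x \<in> tensors_below d n" for x
    using Suc.IH[OF that] by (cases "x = 0") (auto simp: sig_inner_left_simps)
  have one: "sig_inner d (word []) (word []) = 1" by (simp add: sig_inner_word)
  show ?case
  proof (cases "\<exists>a\<in>{1..d}. letter_derivative a f \<noteq> 0")
    case False
    have "f \<in> tensor_space d" using Suc.prems tensors_below_subset_tensor_space by blast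
    then have "f = Poly_Mapping.lookup f [] *\<^sub>R word []"
      using tensor_eq_sum_letter_derivatives[of f d] False by simp
    then obtain c where c: "f = c *\<^sub>R word []" by blast
    then have "c \<noteq> 0" using Suc.prems by auto
    then show ?thesis
      by (simp add: c sig_inner_left_simps sig_inner_right_simps one flip: power2_eq_square)
  next
    case True
    define W where "W = {u \<in> lists {1..d}. length u < Suc n}"
    have "finite W" unfolding W_def by (rule finite_words_below)
    moreover have "f \<in> span (eigentensor ` W)"
      using Suc.prems tensors_below_subset_span_eigentensors unfolding W_def by blast
    ultimately obtain c where c: "f = (\<Sum>w\<in>W. c w *\<^sub>R eigentensor w)"
      by (rule span_image_finite_expansion)
    \<comment> \<open>The curve from the constant tensor \<open>F 0\<close> to \<open>F 1 = f\<close> along which \<open>s F'(s) = (D - P) F(s)\<close>.\<close>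
    define F where "F s = (\<Sum>w\<in>W. (c w * s ^ length w) *\<^sub>R eigentensor w)" for s :: real
    define h where "h s = sig_inner d (F s) (F s)" for s
    define h' where "h' s = (\<Sum>u\<in>W. \<Sum>v\<in>W. c u * c v *
      (real (length u + length v) * s ^ (length u + length v - 1)) *
      sig_inner d (eigentensor u) (eigentensor v))" for s
    have eig_in: "eigentensor w \<in> tensors_below d (Suc n)" if "w \<in> W" for w
      using that eigentensor_in_tensors_below unfolding W_def by blast
    have F_in: "F s \<in> tensors_below d (Suc n)" for s
      unfolding F_def by (intro subspace_sum subspace_scale subspace_tensors_below eig_in)
    have F1: "F 1 = f" by (simp add: F_def c)
    have h_eq: "h s = (\<Sum>u\<in>W. \<Sum>v\<in>W. c u * c v * s ^ (length u + length v) *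
        sig_inner d (eigentensor u) (eigentensor v))" for s
      unfolding h_def F_def
      by (simp only: sig_inner_left_simps)
         (simp add: sig_inner_right_simps sum_distrib_left power_add mult_ac)
    have deriv: "(h has_real_derivative h' s) (at s)" for s
      unfolding h_eq[abs_def] h'_def by (auto intro!: derivative_eq_intros sum.cong)
    have lyap: "real (length u + length v) * sig_inner d (eigentensor u) (eigentensor v) =
        2 * (\<Sum>a\<in>{1..d}. sig_inner d (letter_derivative a (eigentensor u))
          (letter_derivative a (eigentensor v)))" if "u \<in> W" "v \<in> W" for u v
      using lyapunov_identity[of "eigentensor u" d "eigentensor v"] that eig_in
        tensors_below_subset_tensor_space[of d "Suc n"]
      by (auto simp: eigentensor_eigenvector sig_inner_left_simps sig_inner_right_simps algebra_simps)
    have h'_eq: "s * h' s = 2 * (\<Sum>a\<in>{1..d}. sig_inner d (letter_derivative a (F s)) (letter_derivative a (F s)))"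
      for s
    proof -
      have pow: "s * (x * (real k * s ^ (k - 1)) * y) = x * s ^ k * (real k * y)" for x y k
        by (cases k) auto
      have "s * h' s = (\<Sum>u\<in>W. \<Sum>v\<in>W. c u * c v * s ^ (length u + length v) *
          (real (length u + length v) * sig_inner d (eigentensor u) (eigentensor v)))"
        unfolding h'_def sum_distrib_left
        by (simp only: pow)
      also have "\<dots> = (\<Sum>u\<in>W. \<Sum>v\<in>W. c u * c v * s ^ (length u + length v) *
          (2 * (\<Sum>a\<in>{1..d}. sig_inner d (letter_derivative a (eigentensor u))
          (letter_derivative a (eigentensor v)))))"
        by (intro sum.cong refl) (simp only: lyap)
      also have "\<dots> = (\<Sum>u\<in>W. \<Sum>v\<in>W. \<Sum>a\<in>{1..d}. 2 * (c u * s ^ length u * (c v * s ^ length v *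
          sig_inner d (letter_derivative a (eigentensor u)) (letter_derivative a (eigentensor v)))))"
        by (simp add: sum_distrib_left power_add mult_ac)
      also have "\<dots> = (\<Sum>a\<in>{1..d}. \<Sum>u\<in>W. \<Sum>v\<in>W. 2 * (c u * s ^ length u * (c v * s ^ length v *
          sig_inner d (letter_derivative a (eigentensor u)) (letter_derivative a (eigentensor v)))))"
        by (simp only: sum.swap[of _ "{1..d}" W])
      also have "\<dots> = 2 * (\<Sum>a\<in>{1..d}. sig_inner d (letter_derivative a (F s)) (letter_derivative a (F s)))"
        unfolding F_def
        by (simp only: linear_operators_simps sig_inner_left_simps)
           (simp add: sig_inner_right_simps sum_distrib_left mult_ac)
      finally show ?thesis .
    qed
    have der_nonneg: "sig_inner d (letter_derivative a (F s)) (letter_derivative a (F s)) \<ge> 0" for a s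
      using nonneg letter_derivative_in_tensors_below[OF F_in] by blast
    have h'_nonneg: "h' s \<ge> 0" if "s > 0" for s
    proof -
      have "s * h' s \<ge> 0" unfolding h'_eq by (intro mult_nonneg_nonneg sum_nonneg der_nonneg) simp
      then show ?thesis using that by (simp add: zero_le_mult_iff)
    qed
    have "h' 1 > 0"
    proof -
      obtain a where a: "a \<in> {1..d}" "letter_derivative a f \<noteq> 0" using True by blast
      have "(\<Sum>a\<in>{1..d}. sig_inner d (letter_derivative a f) (letter_derivative a f)) > 0"
        using a der_nonneg[of _ 1] Suc.IH[OF letter_derivative_in_tensors_below[OF Suc.prems(1)] a(2)]
        by (intro sum_pos2[of _ a]) (auto simp: F1)
      then show ?thesis using h'_eq[of 1] by (simp add: F1)
    qed
    then obtain \<delta> where \<delta>: "\<delta> > 0" "\<And>e. 0 < e \<Longrightarrow> e < \<delta> \<Longrightarrow> h (1 - e) < h 1"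
      using DERIV_pos_inc_left[OF deriv] by metis
    define e where "e = min (1 / 2) (\<delta> / 2)"
    have e: "0 < e" "e < \<delta>" "e < 1" using \<delta>(1) by (auto simp: e_def)
    \<comment> \<open>The sign of \<open>h'\<close> is not known at 0, so monotonicity uses only the open interval.\<close>
    have "h 0 \<le> h (1 - e)"
      by (rule DERIV_nonneg_imp_increasing_open)
        (use e deriv h'_nonneg in \<open>auto intro!: continuous_at_imp_continuous_on DERIV_isCont\<close>)
    moreover have "h 0 \<ge> 0"
    proof -
      have "F 0 = (\<Sum>w\<in>W. if w = [] then c [] *\<^sub>R word [] else 0)"
        unfolding F_def by (intro sum.cong) (auto simp: eigentensor_def power_0_left)
      also have "\<dots> = c [] *\<^sub>R word []"
        using \<open>finite W\<close> by (simp add: sum.delta W_def)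
      finally show ?thesis by (simp add: h_def sig_inner_left_simps sig_inner_right_simps one)
    qed
    ultimately show ?thesis using \<delta>(2)[OF e(1,2)] by (simp add: h_def F1)
  qed
qed

section \<open>Orthogonal projections onto finitely generated subspaces\<close>

lemma ex_orthogonal_projection:
  fixes ip :: "'v::real_vector \<Rightarrow> 'v \<Rightarrow> real"
  assumes lin: "\<And>y. linear (\<lambda>x. ip x y)" and sym: "\<And>x y. ip x y = ip y x"
    and fin: "finite S" and pos: "\<And>x. x \<in> span S \<Longrightarrow> x \<noteq> 0 \<Longrightarrow> ip x x > 0"
  shows "\<exists>q\<in>span S. \<forall>u\<in>span S. ip (x - q) u = 0"
  using fin pos
proof (induction S arbitrary: x rule: finite_induct)
  case empty
  then show ?case using linear_0[OF lin, of "0"] sym by simp (metis lin linear_0)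
next
  case (insert s S)
  note lin_simps = linear_add[OF lin] linear_diff[OF lin] linear_cmul[OF lin] linear_0[OF lin]
  have pos: "ip x x > 0" if "x \<in> span S" "x \<noteq> 0" for x
    using insert.prems that span_mono[of S "insert s S"] by blast
  obtain p where p: "p \<in> span S" "\<forall>u\<in>span S. ip (s - p) u = 0" using insert.IH pos by blast
  obtain q where q: "q \<in> span S" "\<forall>u\<in>span S. ip (x - q) u = 0" using insert.IH pos by blast
  \<comment> \<open>One Gram-Schmidt step. If \<open>e = 0\<close>, then \<open>r = q\<close>, as \<open>s\<close> does not enlarge the span.\<close>
  define e where "e = s - p"
  define r where "r = q + (ip x e / ip e e) *\<^sub>R e"
  have sub: "span S \<subseteq> span (insert s S)" by (rule span_mono) blast
  have e_in: "e \<in> span (insert s S)"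
    unfolding e_def using p(1) sub by (intro span_diff) (auto intro: span_base)
  have "r \<in> span (insert s S)"
    unfolding r_def using q(1) sub e_in by (intro span_add span_scale) auto
  moreover have "ip (x - r) u = 0" if u: "u \<in> span (insert s S)" for u
  proof -
    obtain k where "u - k *\<^sub>R s \<in> span S" using u span_breakdown_eq by blast
    then have "(u - k *\<^sub>R s) + k *\<^sub>R p \<in> span S" using p(1) by (intro span_add span_scale)
    then have k: "u - k *\<^sub>R e \<in> span S" by (simp add: e_def algebra_simps)
    have 1: "ip (x - r) (u - k *\<^sub>R e) = 0"
      using p(2) q(2) k by (simp add: r_def diff_diff_eq[symmetric] lin_simps e_def)
    have "ip (x - r) e = 0"
    proof (cases "e = 0")
      case True
      then show ?thesis using sym lin_simps(4) by metis
    next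
      case False
      then have "ip e e > 0" using insert.prems e_in by blast
      moreover have "ip q e = 0" using p(2) q(1) sym unfolding e_def by metis
      ultimately show ?thesis by (simp add: r_def lin_simps)
    qed
    then have "ip (k *\<^sub>R e) (x - r) = 0" by (simp add: lin_simps(3) sym[of e])
    moreover have "ip (u - k *\<^sub>R e) (x - r) = 0" using 1 by (simp add: sym[of "u - k *\<^sub>R e"])
    ultimately have "ip u (x - r) = 0"
      using lin_simps(1)[of "u - k *\<^sub>R e" "k *\<^sub>R e" "x - r"] by simp
    then show ?thesis by (simp add: sym[of u])
  qed
  ultimately show ?case by blast
qed

lemma orth_proj_correct:
  fixes ip :: "'v::real_vector \<Rightarrow> 'v \<Rightarrow> real"
  assumes lin: "\<And>y. linear (\<lambda>x. ip x y)" and sym: "\<And>x y. ip x y = ip y x"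
    and fin: "finite S" and pos: "\<And>x. x \<in> span S \<Longrightarrow> x \<noteq> 0 \<Longrightarrow> ip x x > 0"
  shows "orth_proj ip (span S) x \<in> span S"
    and "u \<in> span S \<Longrightarrow> ip (x - orth_proj ip (span S) x) u = 0"
proof -
  let ?P = "\<lambda>q. q \<in> span S \<and> (\<forall>u\<in>span S. ip (x - q) u = 0)"
  obtain q where q: "?P q" using ex_orthogonal_projection[OF assms] by blast
  have "q' = q" if "?P q'" for q'
  proof (rule ccontr)
    assume "q' \<noteq> q"
    have in_S: "q' - q \<in> span S" using q that by (intro span_diff) auto
    then have "ip (x - q) (q' - q) - ip (x - q') (q' - q) = 0" using q that by simp
    then have "ip (q' - q) (q' - q) = 0" by (simp add: linear_diff[OF lin])
    then show False using pos[OF in_S] \<open>q' \<noteq> q\<close> by simp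
  qed
  then have "?P (orth_proj ip (span S) x)"
    unfolding orth_proj_def using theI[of ?P, OF q] by blast
  then show "orth_proj ip (span S) x \<in> span S"
    and "u \<in> span S \<Longrightarrow> ip (x - orth_proj ip (span S) x) u = 0" by blast+
qed

lemma orth_proj_sig_inner:
  shows "orth_proj (sig_inner d) (tensors_below d n) x \<in> tensors_below d n"
    and "u \<in> tensors_below d n \<Longrightarrow>
      sig_inner d (x - orth_proj (sig_inner d) (tensors_below d n) x) u = 0"
proof -
  have fin: "finite (word ` {u \<in> lists {1..d}. length u < n})"
    using finite_words_below by blast
  have pos: "sig_inner d x x > 0" if "x \<in> span (word ` {u \<in> lists {1..d}. length u < n})" "x \<noteq> 0" for x
    using sig_inner_pos that unfolding tensors_below_def by blast
  note * = orth_proj_correct[of "sig_inner d", OF linear_sig_inner_left sig_inner_commute fin pos]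
  show "orth_proj (sig_inner d) (tensors_below d n) x \<in> tensors_below d n"
    and "u \<in> tensors_below d n \<Longrightarrow>
      sig_inner d (x - orth_proj (sig_inner d) (tensors_below d n) x) u = 0"
    using * unfolding tensors_below_def by blast+
qed

section \<open>A word whose projection depends on the dimension\<close>

text \<open>
  The tensor \<open>5 (133 - 331) - (122 - 221)\<close>. Both differences are antisymmetric under reversal of words,
  which makes them orthogonal to the palindromes 1, 111 and 212. The inner products of 122 with
  \<open>133 - 331\<close> and with \<open>122 - 221\<close> are \<open>1/24\<close> and \<open>5/24\<close>, hence the factor 5. All other words of length
  at most 4 in the letters 1 and 2, apart from 221, have the wrong parity in some letter.
\<close>

definition witness :: tensor where
  "witness = 5 *\<^sub>R word [1, 3, 3] - 5 *\<^sub>R word [3, 3, 1] - word [1, 2, 2] + word [2, 2, 1]"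

text \<open>
  As a rewrite rule, this evaluates the form on words without expanding shuffles, whose number grows
  much faster.
\<close>

lemma sig_inner_word_Cons_eq:
  assumes "a \<in> {1..d}" "b \<in> {1..d}"
  shows "sig_inner d (word (a # u)) (word (b # v)) =
    (sig_inner d (remove_letter a u) (word (b # v)) +
     sig_inner d (word (a # u)) (remove_letter b v) +
     (if a = b then 2 * sig_inner d (word u) (word v) else 0)) /
    real (length u + length v + 2)"
  using sig_inner_word_Cons[OF assms, of u v] by (simp add: field_simps)

lemma sig_inner_word_Nil:
  "sig_inner d (word []) (word v) = expected_signature d v"
  "sig_inner d (word u) (word []) = expected_signature d u"
  by (simp_all add: sig_inner_word)

lemmas sig_inner_eval = sig_inner_word_Cons_eq sig_inner_word_Nil
  sig_inner_left_simps sig_inner_right_simps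

lemma witness_orthogonal_short_word:
  assumes "u \<in> lists {1, 2}" "length u < 5"
  shows "sig_inner 3 (word u) witness = 0"
proof -
  consider "u = []" | a where "u = [a]" | a b where "u = [a, b]"
    | a b c where "u = [a, b, c]" | a b c e where "u = [a, b, c, e]"
    using assms(2) by (auto simp: less_Suc_eq length_Suc_conv numeral_eq_Suc)
  then show ?thesis
    by cases (use assms(1) in \<open>auto simp: witness_def sig_inner_eval\<close>)
qed

lemma sig_inner_word_witness: "sig_inner 3 (word [1, 1, 2, 2, 1]) witness = - 1 / 48"
  by (simp add: witness_def sig_inner_eval)

lemma tensor_map_id: "tensor_map (\<lambda>v. v) f = f"
proof (rule linear_eq_on_words[where f = f])
  have "vec_tensor (Poly_Mapping.single i 1) = word [i]" for i
    by (simp add: vec_tensor_def lin_ext_def)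
  moreover have "prod_list (map (\<lambda>i. word [i]) w) = word w" for w
    by (induction w) (simp_all add: word_Nil word_mult)
  ultimately show "tensor_map (\<lambda>v. v) (word w) = word w" for w
    by (simp add: tensor_map_word)
qed (simp_all add: tensor_map_def linear_lin_ext linear_ident)

theorem theorem4p3:
  shows "\<not> natural_family {2..} block_orth"
proof
  assume nat: "natural_family {2..} block_orth"
  let ?w = "[1, 1, 2, 2, 1] :: nat list"
  let ?q = "\<lambda>d. orth_proj (sig_inner d) (tensors_below d 5) (word ?w)"
  have "linear_isometry 2 3 (\<lambda>v. v)"
    by (auto simp: linear_isometry_def euclid_def)
  moreover have "word ?w \<in> tensor_space 2"
    unfolding tensor_space_def by (intro span_base imageI) auto
  moreover have "inj_on (\<lambda>v. v) (euclid 2)" by simp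
  ultimately have "tensor_map (\<lambda>v. v) (block_orth 2 (word ?w)) = block_orth 3 (tensor_map (\<lambda>v. v) (word ?w))"
    using nat[unfolded natural_family_def, rule_format, of 2 3 "\<lambda>v. v" "word ?w"] by simp
  then have "block_orth_word 2 ?w = block_orth_word 3 ?w"
    by (simp only: tensor_map_id block_orth_on_word)
  moreover have "length ?w = 5" by simp
  ultimately have "word ?w - ?q 2 = word ?w - ?q 3"
    unfolding block_orth_word_def tensors_below_def by (simp only:)
  then have q_eq: "?q 2 = ?q 3" by simp
  have "witness \<in> tensors_below 3 5"
    unfolding witness_def
    by (intro subspace_add subspace_diff subspace_scale subspace_tensors_below word_in_tensors_below) auto
  then have "sig_inner 3 (word ?w - ?q 3) witness = 0" by (rule orth_proj_sig_inner)
  moreover have "sig_inner 3 (?q 2) witness = 0"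
  proof (rule linear_eq_on_span[OF linear_sig_inner_left linear_zero])
    show "?q 2 \<in> span (word ` {u \<in> lists {1..2}. length u < 5})"
      using orth_proj_sig_inner(1)[of 2 5] unfolding tensors_below_def .
    have "{1..2} = {1, 2::nat}" by auto
    then show "sig_inner 3 x witness = 0" if "x \<in> word ` {u \<in> lists {1..2}. length u < 5}" for x
      using that witness_orthogonal_short_word by auto
  qed
  ultimately have "sig_inner 3 (word ?w) witness = 0"
    using q_eq by (simp add: sig_inner_left_simps)
  then show False using sig_inner_word_witness by simp
qed

end
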